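(* On $S^7$, the second order differential operators $\Delta_{sR}=\sum_{a=2}^7X_a^2$ and $X_1^2$ commute.
   Context: On $S^7\subset\mathbb{R}^8$ with coordinates $x=(x_0,\ldots,x_7)$, consider the vector fields (orthonormal frame of $TS^7$ for the round metric), written as the coefficient vectors with respect to $(\partial_{x_0},\ldots,\partial_{x_7})$: $X_1=(-x_1,x_0,-x_3,x_2,-x_5,x_4,-x_7,x_6)$, $X_2=(-x_2,x_3,x_0,-x_1,-x_6,x_7,x_4,-x_5)$, $X_3=(-x_3,-x_2,x_1,x_0,x_7,x_6,-x_5,-x_4)$, $X_4=(-x_4,x_5,x_6,-x_7,x_0,-x_1,-x_2,x_3)$, $X_5=(-x_5,-x_4,-x_7,-x_6,x_1,x_0,x_3,x_2)$, $X_6=(-x_6,x_7,-x_4,x_5,x_2,-x_3,x_0,-x_1)$, $X_7=(-x_7,-x_6,x_5,x_4,-x_3,-x_2,x_1,x_0)$. The operator $\Delta_{sR}$ is the intrinsic sub-Laplacian of the contact distribution $\mathrm{span}\{X_2,\ldots,X_7\}$ with the restricted round metric. Vector fields act as derivations on $C^\infty(S^7)$, and commutation is understood as operators on $C^\infty(S^7)$. *)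

theory Defs
  imports "HOL-Analysis.Analysis"
begin

section \<open>Smooth functions on the sphere\<close>

primrec Ck_on :: "nat \<Rightarrow> (real^8) set \<Rightarrow> (real^8 \<Rightarrow> real) \<Rightarrow> bool" where
  "Ck_on 0 U F \<longleftrightarrow> continuous_on U F"
| "Ck_on (Suc k) U F \<longleftrightarrow>
     (\<forall>x\<in>U. F differentiable (at x)) \<and>
     (\<forall>v. Ck_on k U (\<lambda>x. frechet_derivative F (at x) v))"

text \<open>Only used for open sets; there it is the usual notion of a \<open>C\<^sup>\<infinity>\<close> function.\<close>

definition smooth_on :: "(real^8) set \<Rightarrow> (real^8 \<Rightarrow> real) \<Rightarrow> bool" where
  "smooth_on U F \<longleftrightarrow> (\<forall>k. Ck_on k U F)"

abbreviation S7 :: "(real^8) set" where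
  "S7 \<equiv> sphere 0 1"

text \<open>
  A function on the sphere is represented by a total function on the ambient space of which only
  the values on the sphere matter; correspondingly, equality of such functions is equality on
  \<open>S7\<close>. It is smooth if near each point of the sphere it is the restriction of a
  smooth function defined on an open subset of the ambient space.
\<close>

definition local_extension :: "(real^8 \<Rightarrow> real) \<Rightarrow> real^8 \<Rightarrow> (real^8) set \<Rightarrow> (real^8 \<Rightarrow> real) \<Rightarrow> bool" where
  "local_extension f p U F \<longleftrightarrow>
     open U \<and> p \<in> U \<and> smooth_on U F \<and> (\<forall>x\<in>U \<inter> S7. F x = f x)"

definition smooth_S7 :: "(real^8 \<Rightarrow> real) set" where
  "smooth_S7 = {f. \<forall>p\<in>S7. \<exists>U F. local_extension f p U F}"

text \<open>
  The derivative of \<open>f\<close> along a vector \<open>v\<close> tangent to the sphere at \<open>p\<close>. That the value does not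
  depend on the extension is shown in \<open>tangent_deriv_eq\<close> below.
\<close>

definition tangent_deriv :: "(real^8 \<Rightarrow> real) \<Rightarrow> real^8 \<Rightarrow> real^8 \<Rightarrow> real" where
  "tangent_deriv f p v =
     (THE d. \<exists>U F. local_extension f p U F \<and> d = frechet_derivative F (at p) v)"

definition vf_apply :: "(real^8 \<Rightarrow> real^8) \<Rightarrow> (real^8 \<Rightarrow> real) \<Rightarrow> (real^8 \<Rightarrow> real)" where
  "vf_apply Y f = (\<lambda>p. tangent_deriv f p (Y p))"

text \<open>
  The components of \<open>[Y, Z]\<close> are its values on the coordinate functions.
\<close>

definition lie_bracket :: "(real^8 \<Rightarrow> real^8) \<Rightarrow> (real^8 \<Rightarrow> real^8) \<Rightarrow> (real^8 \<Rightarrow> real^8)" where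
  "lie_bracket Y Z =
     (\<lambda>p. \<chi> i. vf_apply Y (\<lambda>x. Z x $ i) p - vf_apply Z (\<lambda>x. Y x $ i) p)"

section \<open>The frame\<close>

text \<open>
  The index type \<open>8\<close> consists of the eight distinct elements \<open>0, \<dots>, 7\<close>, so
  \<open>x $ i\<close> below is literally the coordinate \<open>x\<^sub>i\<close>. (The library's \<open>vector\<close> starts counting at 1
  and would shift the coordinates.)
\<close>

definition vec8 :: "real \<Rightarrow> real \<Rightarrow> real \<Rightarrow> real \<Rightarrow> real \<Rightarrow> real \<Rightarrow> real \<Rightarrow> real \<Rightarrow> real^8" where
  "vec8 a0 a1 a2 a3 a4 a5 a6 a7 =
     (\<chi> i. if i = 0 then a0 else if i = 1 then a1 else if i = 2 then a2 else if i = 3 then a3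
           else if i = 4 then a4 else if i = 5 then a5 else if i = 6 then a6 else a7)"

definition X :: "nat \<Rightarrow> real^8 \<Rightarrow> real^8" where
  "X a x =
    (if a = 1 then vec8 (- x$1) (x$0) (- x$3) (x$2) (- x$5) (x$4) (- x$7) (x$6)
      else if a = 2 then vec8 (- x$2) (x$3) (x$0) (- x$1) (- x$6) (x$7) (x$4) (- x$5)
      else if a = 3 then vec8 (- x$3) (- x$2) (x$1) (x$0) (x$7) (x$6) (- x$5) (- x$4)
      else if a = 4 then vec8 (- x$4) (x$5) (x$6) (- x$7) (x$0) (- x$1) (- x$2) (x$3)
      else if a = 5 then vec8 (- x$5) (- x$4) (- x$7) (- x$6) (x$1) (x$0) (x$3) (x$2)
      else if a = 6 then vec8 (- x$6) (x$7) (- x$4) (x$5) (x$2) (- x$3) (x$0) (- x$1)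
      else if a = 7 then vec8 (- x$7) (- x$6) (x$5) (x$4) (- x$3) (- x$2) (x$1) (x$0)
      else 0)"

section \<open>The sub-Laplacian\<close>

definition contact_distribution :: "real^8 \<Rightarrow> (real^8) set" where
  "contact_distribution p = span ((\<lambda>a. X a p) ` {2..7})"

definition horizontal_gradient :: "(real^8 \<Rightarrow> real) \<Rightarrow> real^8 \<Rightarrow> real^8" where
  "horizontal_gradient f p =
     (THE v. v \<in> contact_distribution p \<and>
             (\<forall>w\<in>contact_distribution p. v \<bullet> w = tangent_deriv f p w))"

text \<open>
  The intrinsic sub-Laplacian is the divergence, with respect to Popp's volume, of the horizontal
  gradient. For a distribution of step two and corank one with horizontal orthonormal frame
  \<open>X\<^sub>2, \<dots>, X\<^sub>7\<close> and complementary field \<open>X\<^sub>1\<close>, Popp's volume is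
  \<open>B\<^sup>-\<^sup>1\<^sup>/\<^sup>2 \<nu>\<^sup>1 \<and> \<dots> \<and> \<nu>\<^sup>7\<close> where \<open>\<nu>\<^sup>1, \<dots>, \<nu>\<^sup>7\<close> is the dual coframe and \<open>B\<close> is the sum of the
  squares of the \<open>\<nu>\<^sup>1([X\<^sub>i, X\<^sub>j])\<close>. Here \<open>\<nu>\<^sup>a(w)\<close> is \<open>w \<bullet> X\<^sub>a\<close>, as the whole frame is orthonormal.
\<close>

definition popp_density :: "real^8 \<Rightarrow> real" where
  "popp_density p =
     1 / sqrt (\<Sum>i = 2..7. \<Sum>j = 2..7. (lie_bracket (X i) (X j) p \<bullet> X 1 p)\<^sup>2)"

text \<open>
  With \<open>\<mu> = g \<nu>\<^sup>1 \<and> \<dots> \<and> \<nu>\<^sup>7\<close>, evaluating the Lie derivative of \<open>\<mu>\<close> along \<open>Y\<close>, which is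
  \<open>div(Y) \<mu>\<close> by definition of the divergence, on \<open>X\<^sub>1, \<dots>, X\<^sub>7\<close> gives
  \<open>g div(Y) = Y(g) - g (\<nu>\<^sup>1([Y, X\<^sub>1]) + \<dots> + \<nu>\<^sup>7([Y, X\<^sub>7]))\<close>.
\<close>

definition popp_divergence :: "(real^8 \<Rightarrow> real^8) \<Rightarrow> real^8 \<Rightarrow> real" where
  "popp_divergence Y p =
     vf_apply Y popp_density p / popp_density p
     - (\<Sum>a = 1..7. lie_bracket Y (X a) p \<bullet> X a p)"

definition sub_Laplacian :: "(real^8 \<Rightarrow> real) \<Rightarrow> (real^8 \<Rightarrow> real)" where
  "sub_Laplacian f = popp_divergence (horizontal_gradient f)"

definition X_squared :: "nat \<Rightarrow> (real^8 \<Rightarrow> real) \<Rightarrow> (real^8 \<Rightarrow> real)" where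
  "X_squared a f = vf_apply (X a) (vf_apply (X a) f)"

text \<open>
  Operators commute on \<open>C\<^sup>\<infinity>(S7)\<close> if they agree, as functions on the sphere, when composed in
  either order.
\<close>

definition commute_on_smooth_S7 ::
  "((real^8 \<Rightarrow> real) \<Rightarrow> (real^8 \<Rightarrow> real)) \<Rightarrow> ((real^8 \<Rightarrow> real) \<Rightarrow> (real^8 \<Rightarrow> real)) \<Rightarrow> bool" where
  "commute_on_smooth_S7 P Q \<longleftrightarrow> (\<forall>f\<in>smooth_S7. \<forall>p\<in>S7. P (Q f) p = Q (P f) p)"

section \<open>Well-definedness\<close>

lemma local_extension_differentiable:
  assumes "local_extension f p U F"
  shows "F differentiable (at p)"
proof -
  have "Ck_on (Suc 0) U F" "p \<in> U"
    using assms by (auto simp: local_extension_def smooth_on_def simp del: Ck_on.simps)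
  then show ?thesis by simp
qed

lemma extension_deriv_unique:
  assumes F: "local_extension f p U F" and G: "local_extension f p V G"
    and p: "p \<in> S7" and v: "v \<bullet> p = 0"
  shows "frechet_derivative F (at p) v = frechet_derivative G (at p) v"
proof (cases "v = 0")
  case True
  then show ?thesis
    using local_extension_differentiable[OF F] local_extension_differentiable[OF G]
    by (metis frechet_derivative_works has_derivative_linear linear_0)
next
  case False
  define n where "n = norm v"
  have n: "n > 0" using False by (simp add: n_def)
  define c where "c = (\<lambda>t. cos (n * t) *\<^sub>R p + (sin (n * t) / n) *\<^sub>R v)"
  have pp: "p \<bullet> p = 1" using p by (simp add: dot_square_norm)
  have vv: "v \<bullet> v = n\<^sup>2" by (simp add: n_def dot_square_norm)
  have "c t \<bullet> c t = (cos (n * t))\<^sup>2 + (sin (n * t))\<^sup>2" for t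
    using n v pp vv by (simp add: c_def inner_add_left inner_add_right inner_commute[of p v] power2_eq_square)
  then have cS: "c t \<in> S7" for t by (simp add: norm_eq_1)
  have c0: "c 0 = p" by (simp add: c_def)
  have cd: "(c has_vector_derivative v) (at 0)"
    unfolding c_def using n by (auto intro!: derivative_eq_intros)
  have cc: "isCont c 0" using cd has_vector_derivative_continuous by blast
  have chain: "((H \<circ> c) has_vector_derivative frechet_derivative H (at p) v) (at 0)"
    if "H differentiable (at p)" for H :: "real^8 \<Rightarrow> real"
  proof -
    have "(H has_derivative frechet_derivative H (at p)) (at (c 0))"
      using that c0 by (simp add: frechet_derivative_works)
    from vector_derivative_diff_chain_within[OF cd has_derivative_at_withinI[OF this]]
    show ?thesis by simp
  qed
  have "open (U \<inter> V)" "c 0 \<in> U \<inter> V"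
    using F G c0 by (auto simp: local_extension_def)
  moreover have "filterlim c (nhds (c 0)) (nhds 0)"
    using cc by (simp add: isCont_def tendsto_at_iff_tendsto_nhds)
  ultimately have "\<forall>\<^sub>F t in nhds 0. c t \<in> U \<inter> V"
    by (rule topological_tendstoD[rotated 1])
  then have ev: "\<forall>\<^sub>F t in nhds 0. (F \<circ> c) t = (G \<circ> c) t"
    by eventually_elim (use F G cS in \<open>auto simp: local_extension_def\<close>)
  have Fd: "((F \<circ> c) has_vector_derivative frechet_derivative F (at p) v) (at 0)"
    by (rule chain[OF local_extension_differentiable[OF F]])
  have Gd: "((G \<circ> c) has_vector_derivative frechet_derivative G (at p) v) (at 0)"
    by (rule chain[OF local_extension_differentiable[OF G]])
  have "((F \<circ> c) has_vector_derivative frechet_derivative G (at p) v) (at 0)"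
    using Gd ev by (subst has_vector_derivative_cong_ev) (auto elim!: eventually_mono dest: eventually_nhds_x_imp_x)
  with Fd show ?thesis by (rule vector_derivative_unique_at)
qed

lemma tangent_deriv_eq:
  assumes "local_extension f p U F" "p \<in> S7" "v \<bullet> p = 0"
  shows "tangent_deriv f p v = frechet_derivative F (at p) v"
  unfolding tangent_deriv_def
  using assms extension_deriv_unique by (intro the_equality) blast+

lemma UNIV_8: "(UNIV :: 8 set) = {0, 1, 2, 3, 4, 5, 6, 7}"
  by (rule sym, rule card_subset_eq) simp_all

lemma inner_8:
  "(x :: real^8) \<bullet> y = x$0 * y$0 + x$1 * y$1 + x$2 * y$2 + x$3 * y$3
     + x$4 * y$4 + x$5 * y$5 + x$6 * y$6 + x$7 * y$7"
  unfolding inner_vec_def UNIV_8 by simp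

lemma vec8_nth [simp]:
  "vec8 a0 a1 a2 a3 a4 a5 a6 a7 $ 0 = a0" "vec8 a0 a1 a2 a3 a4 a5 a6 a7 $ 1 = a1"
  "vec8 a0 a1 a2 a3 a4 a5 a6 a7 $ 2 = a2" "vec8 a0 a1 a2 a3 a4 a5 a6 a7 $ 3 = a3"
  "vec8 a0 a1 a2 a3 a4 a5 a6 a7 $ 4 = a4" "vec8 a0 a1 a2 a3 a4 a5 a6 a7 $ 5 = a5"
  "vec8 a0 a1 a2 a3 a4 a5 a6 a7 $ 6 = a6" "vec8 a0 a1 a2 a3 a4 a5 a6 a7 $ 7 = a7"
  by (simp_all add: vec8_def)

lemma atLeastAtMost_1_7: "{1..7::nat} = {1, 2, 3, 4, 5, 6, 7}"
  by auto

lemma X_simps: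
  "X (Suc 0) x = vec8 (- x$1) (x$0) (- x$3) (x$2) (- x$5) (x$4) (- x$7) (x$6)"
  "X 2 x = vec8 (- x$2) (x$3) (x$0) (- x$1) (- x$6) (x$7) (x$4) (- x$5)"
  "X 3 x = vec8 (- x$3) (- x$2) (x$1) (x$0) (x$7) (x$6) (- x$5) (- x$4)"
  "X 4 x = vec8 (- x$4) (x$5) (x$6) (- x$7) (x$0) (- x$1) (- x$2) (x$3)"
  "X 5 x = vec8 (- x$5) (- x$4) (- x$7) (- x$6) (x$1) (x$0) (x$3) (x$2)"
  "X 6 x = vec8 (- x$6) (x$7) (- x$4) (x$5) (x$2) (- x$3) (x$0) (- x$1)"
  "X 7 x = vec8 (- x$7) (- x$6) (x$5) (x$4) (- x$3) (- x$2) (x$1) (x$0)"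
  by (simp_all only: X_def) simp_all

lemma X_tangent:
  assumes "a \<in> {1..7}"
  shows "X a x \<bullet> x = 0"
  using assms unfolding atLeastAtMost_1_7
  by (elim insertE emptyE) (simp_all add: X_simps inner_8)

lemma X_orthonormal:
  assumes "x \<in> S7" "a \<in> {1..7}" "b \<in> {1..7}"
  shows "X a x \<bullet> X b x = (if a = b then 1 else 0)"
proof -
  have "x \<bullet> x = 1" using assms(1) by (simp add: dot_square_norm)
  then have 1: "x$0 * x$0 + x$1 * x$1 + x$2 * x$2 + x$3 * x$3
     + x$4 * x$4 + x$5 * x$5 + x$6 * x$6 + x$7 * x$7 = 1"
    by (simp only: inner_8)
  show ?thesis
    using assms(2,3) unfolding atLeastAtMost_1_7
    by (elim insertE emptyE; simp add: X_simps inner_8; use 1 in \<open>simp add: algebra_simps\<close>)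
qed

lemma linear_X: "linear (X a)"
  by (rule linearI) (simp_all add: X_def vec8_def vec_eq_iff)

lemma Ck_on_cong:
  assumes "open U" "\<And>x. x \<in> U \<Longrightarrow> F x = G x" "Ck_on k U F"
  shows "Ck_on k U G"
  using assms(2,3)
proof (induction k arbitrary: F G)
  case 0
  then show ?case by (simp cong: continuous_on_cong)
next
  case (Suc k)
  have d: "(G has_derivative frechet_derivative F (at x)) (at x)" if "x \<in> U" for x
  proof -
    have "(F has_derivative frechet_derivative F (at x)) (at x)"
      using Suc.prems(2) that by (simp add: frechet_derivative_works)
    then show ?thesis
      by (rule has_derivative_transform_within_open[OF _ assms(1) that]) (rule Suc.prems(1))
  qed
  have "Ck_on k U (\<lambda>x. frechet_derivative G (at x) v)" for v
  proof (rule Suc.IH)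
    show "frechet_derivative F (at x) v = frechet_derivative G (at x) v" if "x \<in> U" for x
      using frechet_derivative_at[OF d[OF that]] by simp
    show "Ck_on k U (\<lambda>x. frechet_derivative F (at x) v)"
      using Suc.prems(2) by simp
  qed
  with d show ?case by (auto simp: differentiable_def)
qed

lemma Ck_on_SucD: "Ck_on (Suc k) U F \<Longrightarrow> Ck_on k U F"
proof (induction k arbitrary: F)
  case 0
  then show ?case
    by (auto intro!: differentiable_imp_continuous_on differentiable_at_imp_differentiable_on)
next
  case (Suc k)
  have "\<forall>x\<in>U. F differentiable (at x)"
    and "\<And>v. Ck_on (Suc k) U (\<lambda>x. frechet_derivative F (at x) v)"
    using iffD1[OF Ck_on.simps(2)[of "Suc k"] Suc.prems] by blast+
  with Suc.IH show ?case by simp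
qed

lemma Ck_on_const: "Ck_on k U (\<lambda>x. c)"
  by (induction k arbitrary: c) simp_all

lemma Ck_on_linear:
  assumes "linear L"
  shows "Ck_on k U L"
proof (cases k)
  case 0
  then show ?thesis by (simp add: assms linear_continuous_on linear_linear)
next
  case (Suc k')
  have d: "(L has_derivative L) (at x)" for x
    using assms by (simp add: linear_imp_has_derivative)
  then have "frechet_derivative L (at x) = L" for x
    using frechet_derivative_at[OF d, of x] by simp
  then show ?thesis
    using d unfolding Suc by (auto simp: differentiable_def Ck_on_const)
qed

lemma Ck_on_add:
  assumes "open U" "Ck_on k U F" "Ck_on k U G"
  shows "Ck_on k U (\<lambda>x. F x + G x)"
  using assms(2,3)
proof (induction k arbitrary: F G)
  case 0
  then show ?case by (simp add: continuous_on_add)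
next
  case (Suc k)
  have eq: "frechet_derivative F (at x) v + frechet_derivative G (at x) v
      = frechet_derivative (\<lambda>x. F x + G x) (at x) v" if "x \<in> U" for x v
  proof -
    have "(F has_derivative frechet_derivative F (at x)) (at x)"
      "(G has_derivative frechet_derivative G (at x)) (at x)"
      using Suc.prems that by (simp_all add: frechet_derivative_works)
    from frechet_derivative_at[OF has_derivative_add[OF this]]
    show ?thesis by (rule fun_cong)
  qed
  have "Ck_on k U (\<lambda>x. frechet_derivative (\<lambda>x. F x + G x) (at x) v)" for v
    by (rule Ck_on_cong[OF assms(1) eq]) (use Suc in auto)
  with Suc.prems show ?case by simp
qed

lemma Ck_on_mult:
  assumes "open U" "Ck_on k U F" "Ck_on k U G"
  shows "Ck_on k U (\<lambda>x. F x * G x)"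
  using assms(2,3)
proof (induction k arbitrary: F G)
  case 0
  then show ?case by (simp add: continuous_on_mult)
next
  case (Suc k)
  have eq: "F x * frechet_derivative G (at x) v + frechet_derivative F (at x) v * G x
      = frechet_derivative (\<lambda>x. F x * G x) (at x) v" if "x \<in> U" for x v
  proof -
    have "(F has_derivative frechet_derivative F (at x)) (at x)"
      "(G has_derivative frechet_derivative G (at x)) (at x)"
      using Suc.prems that by (simp_all add: frechet_derivative_works)
    from frechet_derivative_at[OF has_derivative_mult[OF this]]
    show ?thesis by (rule fun_cong)
  qed
  have "Ck_on k U (\<lambda>x. frechet_derivative (\<lambda>x. F x * G x) (at x) v)" for v
  proof (rule Ck_on_cong[OF assms(1) eq])
    show "Ck_on k U (\<lambda>x. F x * frechet_derivative G (at x) v + frechet_derivative F (at x) v * G x)"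
      using Suc.prems Ck_on_SucD[OF Suc.prems(1)] Ck_on_SucD[OF Suc.prems(2)]
      by (intro Ck_on_add[OF assms(1)] Suc.IH) auto
  qed
  with Suc.prems show ?case by simp
qed

lemma Ck_on_sum:
  assumes "open U" "finite I" "\<And>i. i \<in> I \<Longrightarrow> Ck_on k U (F i)"
  shows "Ck_on k U (\<lambda>x. \<Sum>i\<in>I. F i x)"
  using assms(2,3) by induction (simp_all add: Ck_on_const Ck_on_add[OF assms(1)])

lemma vf_apply_X_smooth:
  assumes f: "f \<in> smooth_S7" and a: "a \<in> {1..7}"
  shows "vf_apply (X a) f \<in> smooth_S7"
proof -
  have "\<exists>U F. local_extension (vf_apply (X a) f) p U F" if p: "p \<in> S7" for p
  proof -
    obtain U F where UF: "local_extension f p U F"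
      using f p unfolding smooth_S7_def by blast
    then have U: "open U" "p \<in> U" and F: "\<And>k. Ck_on k U F" and ext: "\<forall>x\<in>U \<inter> S7. F x = f x"
      by (auto simp: local_extension_def smooth_on_def)
    define G where "G = (\<lambda>x. \<Sum>i\<in>UNIV. X a x $ i * frechet_derivative F (at x) (axis i 1))"
    have D: "Ck_on k U (\<lambda>x. frechet_derivative F (at x) v)" for k v
      using F[of "Suc k"] by simp
    have "linear (\<lambda>x. X a x $ i)" for i
      by (rule linearI) (simp_all add: linear_add[OF linear_X] linear_scale[OF linear_X])
    then have "Ck_on k U G" for k
      unfolding G_def by (intro Ck_on_sum Ck_on_mult U D Ck_on_linear) auto
    moreover have "G x = vf_apply (X a) f x" if x: "x \<in> U \<inter> S7" for x
    proof -
      have xe: "local_extension f x U F"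
        using UF x by (auto simp: local_extension_def)
      have l: "linear (frechet_derivative F (at x))"
        using local_extension_differentiable[OF xe] by (rule linear_frechet_derivative)
      have "frechet_derivative F (at x) (X a x)
          = frechet_derivative F (at x) (\<Sum>i\<in>UNIV. X a x $ i *\<^sub>R axis i 1)"
        using basis_expansion[of "X a x"] by (simp add: scalar_mult_eq_scaleR)
      also have "\<dots> = G x"
        by (simp add: G_def linear_sum[OF l] linear_scale[OF l])
      finally show ?thesis
        using tangent_deriv_eq[OF xe _ X_tangent[OF a]] x by (simp add: vf_apply_def)
    qed
    ultimately show ?thesis
      using U by (auto simp: local_extension_def smooth_on_def intro!: exI[of _ U] exI[of _ G])
  qed
  then show ?thesis unfolding smooth_S7_def by blast
qed

end

theory Submission
  imports Defs
begin

text \<open>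
  Popp's density is constant on the sphere and the linear fields \<open>X\<^sub>a\<close> are skew, so the divergence
  of the horizontal gradient reduces to the sum of squares. Moreover \<open>X\<^sub>1\<close> itself commutes with
  \<open>X\<^sub>2\<^sup>2 + \<dots> + X\<^sub>7\<^sup>2\<close>. If \<open>\<phi>\<close> and \<open>Q\<close> are the first and second derivative at \<open>p\<close> of an extension
  of \<open>f\<close>, then linear fields satisfy \<open>A (B f) p = Q (A p) (B p) + \<phi> (B (A p))\<close>. As \<open>Q\<close> is symmetric
  and the matrices \<open>X\<^sub>a\<close> anticommute with \<open>X\<^sub>1\<close>, the commutator \<open>[X\<^sub>1, X\<^sub>a]\<close> is \<open>- 2 C\<^sub>a\<close> for the linear
  field \<open>C\<^sub>a p = X\<^sub>1 (X\<^sub>a p)\<close>, and \<open>[X\<^sub>1, X\<^sub>a\<^sup>2] f\<close> equals \<open>- 4 Q (C\<^sub>a p) (X\<^sub>a p)\<close> because the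
  first-order terms cancel by \<open>X\<^sub>a\<^sup>2 = - 1\<close> for the matrices. Summed over \<open>a\<close>, this is the trace of the
  product of a symmetric and an antisymmetric matrix.
\<close>

section \<open>Symmetry of second derivatives\<close>

text \<open>The mean value theorem is applied twice, first in the direction \<open>u\<close> and
  then in the direction \<open>v\<close>. The second difference on the left is symmetric in
  \<open>u\<close> and \<open>v\<close>, while the right-hand side has a fixed order of
  differentiation.\<close>

lemma second_difference_mean_value:
  fixes F :: "'a::real_normed_vector \<Rightarrow> real"
  assumes h: "0 < h"
    and inU: "\<And>s t. 0 \<le> s \<Longrightarrow> s \<le> h \<Longrightarrow> 0 \<le> t \<Longrightarrow> t \<le> h \<Longrightarrow> p + s *\<^sub>R u + t *\<^sub>R v \<in> U"
    and F: "\<And>x. x \<in> U \<Longrightarrow> F differentiable (at x)"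
    and F': "\<And>x. x \<in> U \<Longrightarrow> (\<lambda>y. frechet_derivative F (at y) u) differentiable (at x)"
  shows "\<exists>s t. 0 \<le> s \<and> s \<le> h \<and> 0 \<le> t \<and> t \<le> h \<and>
    F (p + h *\<^sub>R u + h *\<^sub>R v) - F (p + h *\<^sub>R u) - F (p + h *\<^sub>R v) + F p
    = h * h * frechet_derivative (\<lambda>y. frechet_derivative F (at y) u) (at (p + s *\<^sub>R u + t *\<^sub>R v)) v"
proof -
  have line: "((\<lambda>t. G (q + t *\<^sub>R w)) has_real_derivative frechet_derivative G (at (q + t *\<^sub>R w)) w) (at t)"
    if "G differentiable (at (q + t *\<^sub>R w))" for G :: "'a \<Rightarrow> real" and q w t
  proof -
    have G: "(G has_derivative frechet_derivative G (at (q + t *\<^sub>R w))) (at (q + t *\<^sub>R w))"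
      using that by (simp add: frechet_derivative_works)
    have "((\<lambda>t. q + t *\<^sub>R w) has_vector_derivative w) (at t)"
      by (auto intro!: derivative_eq_intros)
    from vector_derivative_diff_chain_within[OF this has_derivative_at_withinI[OF G]]
    show ?thesis by (simp add: o_def has_real_derivative_iff_has_vector_derivative)
  qed
  let ?D = "\<lambda>y. frechet_derivative F (at y) u"
  \<comment> \<open>The increment of \<open>g\<close> over \<open>[0, h]\<close> is the second
    difference.\<close>
  define g where "g s = F ((p + h *\<^sub>R v) + s *\<^sub>R u) - F (p + s *\<^sub>R u)" for s
  have "(g has_real_derivative ?D ((p + h *\<^sub>R v) + s *\<^sub>R u) - ?D (p + s *\<^sub>R u)) (at s)"
    if "0 \<le> s" "s \<le> h" for s
  proof -
    have "p + h *\<^sub>R v + s *\<^sub>R u \<in> U" "p + s *\<^sub>R u \<in> U"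
      using inU[OF that, of h] inU[OF that, of 0] h by (simp_all add: algebra_simps)
    then show ?thesis unfolding g_def by (intro DERIV_diff line F)
  qed
  from MVT2[OF h this] obtain s where s: "0 < s" "s < h"
    and gs: "g h - g 0 = h * (?D ((p + h *\<^sub>R v) + s *\<^sub>R u) - ?D (p + s *\<^sub>R u))"
    by auto
  have "((\<lambda>t. ?D ((p + s *\<^sub>R u) + t *\<^sub>R v)) has_real_derivative
      frechet_derivative ?D (at ((p + s *\<^sub>R u) + t *\<^sub>R v)) v) (at t)"
    if "0 \<le> t" "t \<le> h" for t
    using s that by (intro line F' inU) auto
  from MVT2[OF h this] obtain t where t: "0 < t" "t < h"
    and gt: "?D ((p + s *\<^sub>R u) + h *\<^sub>R v) - ?D (p + s *\<^sub>R u)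
      = h * frechet_derivative ?D (at ((p + s *\<^sub>R u) + t *\<^sub>R v)) v"
    by auto
  have "F (p + h *\<^sub>R u + h *\<^sub>R v) - F (p + h *\<^sub>R u) - F (p + h *\<^sub>R v) + F p = g h - g 0"
    by (simp add: g_def algebra_simps)
  also have "\<dots> = h * (h * frechet_derivative ?D (at ((p + s *\<^sub>R u) + t *\<^sub>R v)) v)"
    unfolding gs gt[symmetric] by (simp add: algebra_simps)
  finally show ?thesis using s t by (intro exI[of _ s] exI[of _ t]) auto
qed

text \<open>One second difference equals \<open>h * h\<close> times either mixed derivative, each at
  some point of a small parallelogram at \<open>p\<close>. So the two mixed derivatives agree at
  nearby points, and continuity carries this to \<open>p\<close>.\<close>

lemma second_derivative_symmetric:
  fixes F :: "'a::real_normed_vector \<Rightarrow> real"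
  assumes U: "open U" "p \<in> U"
    and F: "\<And>x. x \<in> U \<Longrightarrow> F differentiable (at x)"
    and F': "\<And>x w. x \<in> U \<Longrightarrow> (\<lambda>y. frechet_derivative F (at y) w) differentiable (at x)"
    and F'': "\<And>w z. continuous_on U (\<lambda>x. frechet_derivative (\<lambda>y. frechet_derivative F (at y) w) (at x) z)"
  shows "frechet_derivative (\<lambda>y. frechet_derivative F (at y) u) (at p) v
       = frechet_derivative (\<lambda>y. frechet_derivative F (at y) v) (at p) u"
proof -
  define H where "H w z x = frechet_derivative (\<lambda>y. frechet_derivative F (at y) w) (at x) z" for w z x
  have "\<bar>H u v p - H v u p\<bar> \<le> e" if e: "e > 0" for e
  proof -
    have cont: "\<exists>d>0. \<forall>x. dist x p < d \<longrightarrow> dist (H w z x) (H w z p) < e / 2" for w z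
      using F''[of w z] U e unfolding H_def[symmetric] continuous_on_eq_continuous_at[OF U(1)]
        continuous_at_eps_delta by (metis half_gt_zero)
    obtain d1 where d1: "d1 > 0" "\<And>x. dist x p < d1 \<Longrightarrow> dist (H u v x) (H u v p) < e / 2"
      using cont by blast
    obtain d2 where d2: "d2 > 0" "\<And>x. dist x p < d2 \<Longrightarrow> dist (H v u x) (H v u p) < e / 2"
      using cont by blast
    obtain d3 where d3: "d3 > 0" "\<And>x. dist x p < d3 \<Longrightarrow> x \<in> U"
      using U open_dist by blast
    define d where "d = min d1 (min d2 d3)"
    \<comment> \<open>This keeps the whole parallelogram within distance \<open>d\<close> of
      \<open>p\<close>; the summand 1 covers \<open>u = v = 0\<close> and makes the bound
      strict.\<close>
    define h where "h = d / (norm u + norm v + 1)"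
    have d: "d > 0" using d1 d2 d3 by (simp add: d_def)
    have n: "norm u + norm v + 1 > 0" by (simp add: add_nonneg_pos)
    have h: "h > 0" using d n by (simp add: h_def)
    have near: "dist (p + s *\<^sub>R u + t *\<^sub>R v) p < d" if "0 \<le> s" "s \<le> h" "0 \<le> t" "t \<le> h" for s t
    proof -
      have "dist (p + s *\<^sub>R u + t *\<^sub>R v) p = norm (s *\<^sub>R u + t *\<^sub>R v)"
        by (simp add: dist_norm algebra_simps)
      also have "\<dots> \<le> s * norm u + t * norm v"
        using norm_triangle_ineq[of "s *\<^sub>R u" "t *\<^sub>R v"] that by simp
      also have "\<dots> \<le> h * norm u + h * norm v"
        using that by (intro add_mono mult_right_mono) auto
      also have "\<dots> < h * (norm u + norm v + 1)"
        using h by (simp add: algebra_simps)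
      also have "\<dots> = d" using n by (simp add: h_def)
      finally show ?thesis .
    qed
    then have U1: "p + s *\<^sub>R u + t *\<^sub>R v \<in> U" if "0 \<le> s" "s \<le> h" "0 \<le> t" "t \<le> h" for s t
      using d3(2) that by (simp add: d_def)
    then have U2: "p + s *\<^sub>R v + t *\<^sub>R u \<in> U" if "0 \<le> s" "s \<le> h" "0 \<le> t" "t \<le> h" for s t
      using U1[of t s] that by (simp add: algebra_simps)
    obtain s t where st: "0 \<le> s" "s \<le> h" "0 \<le> t" "t \<le> h"
      and 1: "F (p + h *\<^sub>R u + h *\<^sub>R v) - F (p + h *\<^sub>R u) - F (p + h *\<^sub>R v) + F p
        = h * h * H u v (p + s *\<^sub>R u + t *\<^sub>R v)"
      using second_difference_mean_value[OF h U1 F F'] unfolding H_def by blast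
    obtain s' t' where st': "0 \<le> s'" "s' \<le> h" "0 \<le> t'" "t' \<le> h"
      and 2: "F (p + h *\<^sub>R v + h *\<^sub>R u) - F (p + h *\<^sub>R v) - F (p + h *\<^sub>R u) + F p
        = h * h * H v u (p + s' *\<^sub>R v + t' *\<^sub>R u)"
      using second_difference_mean_value[OF h U2 F F'] unfolding H_def by blast
    have "h * h * H u v (p + s *\<^sub>R u + t *\<^sub>R v) = h * h * H v u (p + s' *\<^sub>R v + t' *\<^sub>R u)"
      unfolding 1[symmetric] 2[symmetric] by (simp add: algebra_simps)
    then have "H u v (p + s *\<^sub>R u + t *\<^sub>R v) = H v u (p + t' *\<^sub>R u + s' *\<^sub>R v)"
      using h by (simp add: algebra_simps)
    moreover have "dist (H u v (p + s *\<^sub>R u + t *\<^sub>R v)) (H u v p) < e / 2"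
      using near[OF st] by (intro d1) (simp add: d_def)
    moreover have "dist (H v u (p + t' *\<^sub>R u + s' *\<^sub>R v)) (H v u p) < e / 2"
      using near[OF st'(3,4,1,2)] by (intro d2) (simp add: d_def)
    ultimately show ?thesis unfolding dist_real_def by linarith
  qed
  then have "\<bar>H u v p - H v u p\<bar> \<le> 0" by (rule field_le_epsilon) simp
  then show ?thesis by (simp add: H_def)
qed

section \<open>Calculus on the sphere\<close>

text \<open>Extensions see \<open>f\<close> only on the sphere, so both functions have the same
  extensions. The equality therefore holds at every point and can be used inside nested
  derivatives.\<close>

lemma tangent_deriv_cong:
  assumes "\<And>x. x \<in> S7 \<Longrightarrow> f x = g x"
  shows "tangent_deriv f = tangent_deriv g"
proof -
  have "local_extension f = local_extension g"
    using assms by (auto simp: local_extension_def fun_eq_iff)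
  then show ?thesis by (simp add: tangent_deriv_def fun_eq_iff)
qed

lemma vf_apply_cong:
  assumes "\<And>x. x \<in> S7 \<Longrightarrow> f x = g x"
  shows "vf_apply Y f = vf_apply Y g"
  using tangent_deriv_cong[OF assms] by (simp add: vf_apply_def)

lemma smooth_S7E:
  assumes "f \<in> smooth_S7" "p \<in> S7"
  obtains U F where "local_extension f p U F"
  using assms unfolding smooth_S7_def by blast

lemma Ck_on_subset: "Ck_on k U F \<Longrightarrow> V \<subseteq> U \<Longrightarrow> Ck_on k V F"
  by (induction k arbitrary: F) (auto intro: continuous_on_subset)

section \<open>Smooth functions form an algebra\<close>

lemma local_extension_add:
  assumes "local_extension f p U F" "local_extension g p V G"
  shows "local_extension (\<lambda>x. f x + g x) p (U \<inter> V) (\<lambda>x. F x + G x)"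
  using assms Ck_on_subset[of _ U F "U \<inter> V"] Ck_on_subset[of _ V G "U \<inter> V"]
  by (auto simp: local_extension_def smooth_on_def intro!: Ck_on_add)

lemma local_extension_mult:
  assumes "local_extension f p U F" "local_extension g p V G"
  shows "local_extension (\<lambda>x. f x * g x) p (U \<inter> V) (\<lambda>x. F x * G x)"
  using assms Ck_on_subset[of _ U F "U \<inter> V"] Ck_on_subset[of _ V G "U \<inter> V"]
  by (auto simp: local_extension_def smooth_on_def intro!: Ck_on_mult)

lemma local_extension_linear: "linear L \<Longrightarrow> local_extension L p UNIV L"
  by (simp add: local_extension_def smooth_on_def Ck_on_linear)

lemma local_extension_const: "local_extension (\<lambda>x. c) p UNIV (\<lambda>x. c)"
  by (simp add: local_extension_def smooth_on_def Ck_on_const)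

lemma smooth_S7_add: "f \<in> smooth_S7 \<Longrightarrow> g \<in> smooth_S7 \<Longrightarrow> (\<lambda>x. f x + g x) \<in> smooth_S7"
  unfolding smooth_S7_def using local_extension_add by blast

lemma smooth_S7_mult: "f \<in> smooth_S7 \<Longrightarrow> g \<in> smooth_S7 \<Longrightarrow> (\<lambda>x. f x * g x) \<in> smooth_S7"
  unfolding smooth_S7_def using local_extension_mult by blast

lemma smooth_S7_linear: "linear L \<Longrightarrow> L \<in> smooth_S7"
  unfolding smooth_S7_def using local_extension_linear by blast

lemma smooth_S7_const: "(\<lambda>x. c) \<in> smooth_S7"
  unfolding smooth_S7_def using local_extension_const by blast

lemma smooth_S7_sum:
  "finite I \<Longrightarrow> (\<And>i. i \<in> I \<Longrightarrow> f i \<in> smooth_S7) \<Longrightarrow> (\<lambda>x. \<Sum>i\<in>I. f i x) \<in> smooth_S7"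
  by (induction rule: finite_induct) (simp_all add: smooth_S7_const smooth_S7_add)

section \<open>Rules for tangential derivatives\<close>

lemma tangent_deriv_add:
  assumes f: "f \<in> smooth_S7" and g: "g \<in> smooth_S7" and p: "p \<in> S7" and v: "v \<bullet> p = 0"
  shows "tangent_deriv (\<lambda>x. f x + g x) p v = tangent_deriv f p v + tangent_deriv g p v"
proof -
  obtain U F where F: "local_extension f p U F" using f p by (rule smooth_S7E)
  obtain V G where G: "local_extension g p V G" using g p by (rule smooth_S7E)
  have "(F has_derivative frechet_derivative F (at p)) (at p)"
    "(G has_derivative frechet_derivative G (at p)) (at p)"
    using local_extension_differentiable F G by (simp_all add: frechet_derivative_works[symmetric])
  from frechet_derivative_at[OF has_derivative_add[OF this], symmetric]
  show ?thesis
    by (simp add: tangent_deriv_eq[OF F p v] tangent_deriv_eq[OF G p v]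
        tangent_deriv_eq[OF local_extension_add[OF F G] p v])
qed

lemma tangent_deriv_mult:
  assumes f: "f \<in> smooth_S7" and g: "g \<in> smooth_S7" and p: "p \<in> S7" and v: "v \<bullet> p = 0"
  shows "tangent_deriv (\<lambda>x. f x * g x) p v = f p * tangent_deriv g p v + tangent_deriv f p v * g p"
proof -
  obtain U F where F: "local_extension f p U F" using f p by (rule smooth_S7E)
  obtain V G where G: "local_extension g p V G" using g p by (rule smooth_S7E)
  have FG: "F p = f p" "G p = g p"
    using F G p by (auto simp: local_extension_def)
  have "(F has_derivative frechet_derivative F (at p)) (at p)"
    "(G has_derivative frechet_derivative G (at p)) (at p)"
    using local_extension_differentiable F G by (simp_all add: frechet_derivative_works[symmetric])
  from frechet_derivative_at[OF has_derivative_mult[OF this], symmetric]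
  show ?thesis
    by (simp add: FG tangent_deriv_eq[OF F p v] tangent_deriv_eq[OF G p v]
        tangent_deriv_eq[OF local_extension_mult[OF F G] p v])
qed

lemma tangent_deriv_const:
  assumes "p \<in> S7" "v \<bullet> p = 0"
  shows "tangent_deriv (\<lambda>x. c) p v = 0"
  using tangent_deriv_eq[OF local_extension_const assms] by simp

lemma tangent_deriv_add_scaled:
  assumes f: "f \<in> smooth_S7" and g: "g \<in> smooth_S7" and p: "p \<in> S7" and v: "v \<bullet> p = 0"
  shows "tangent_deriv (\<lambda>x. f x + c * g x) p v = tangent_deriv f p v + c * tangent_deriv g p v"
  using tangent_deriv_add[OF f smooth_S7_mult[OF smooth_S7_const g] p v]
    tangent_deriv_mult[OF smooth_S7_const g p v] tangent_deriv_const[OF p v]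
  by simp

lemma tangent_deriv_linear:
  assumes "linear L" "p \<in> S7" "v \<bullet> p = 0"
  shows "tangent_deriv L p v = L v"
  using tangent_deriv_eq[OF local_extension_linear assms(2,3)]
    frechet_derivative_at[OF linear_imp_has_derivative, OF assms(1)] assms by metis

lemma tangent_deriv_sum:
  assumes "finite I" "\<And>i. i \<in> I \<Longrightarrow> f i \<in> smooth_S7" "p \<in> S7" "v \<bullet> p = 0"
  shows "tangent_deriv (\<lambda>x. \<Sum>i\<in>I. f i x) p v = (\<Sum>i\<in>I. tangent_deriv (f i) p v)"
  using assms(1,2)
proof induction
  case empty
  then show ?case using tangent_deriv_const[OF assms(3,4)] by simp
next
  case (insert i I)
  then have "f i \<in> smooth_S7" "(\<lambda>x. \<Sum>i\<in>I. f i x) \<in> smooth_S7"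
    by (auto intro: smooth_S7_sum)
  from tangent_deriv_add[OF this assms(3,4)] insert show ?case by simp
qed

text \<open>The derivative of one extension serves as \<open>\<phi>\<close>. It is linear on the
  whole ambient space, so linearity can be applied without tangency conditions.\<close>

lemma tangent_deriv_as_linear:
  assumes f: "f \<in> smooth_S7" and p: "p \<in> S7"
  obtains \<phi> where "linear \<phi>" "\<And>v. v \<bullet> p = 0 \<Longrightarrow> tangent_deriv f p v = \<phi> v"
proof -
  obtain U F where F: "local_extension f p U F" using f p by (rule smooth_S7E)
  show ?thesis
    using linear_frechet_derivative[OF local_extension_differentiable[OF F]] tangent_deriv_eq[OF F p]
    by (rule that)
qed

section \<open>Skew linear vector fields\<close>

text \<open>For linear \<open>A\<close> this is antisymmetry of the matrix, expressed as tangency of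
  the field to every sphere about the origin.\<close>

definition skew :: "(real^8 \<Rightarrow> real^8) \<Rightarrow> bool" where
  "skew A \<longleftrightarrow> linear A \<and> (\<forall>x. A x \<bullet> x = 0)"

lemma skewD:
  assumes "skew A"
  shows "linear A" "A x \<bullet> x = 0"
  using assms by (simp_all add: skew_def)

text \<open>Polarisation of the quadratic identity \<open>A x \<bullet> x = 0\<close>.\<close>

lemma skew_inner:
  assumes "skew A"
  shows "A x \<bullet> y = - (x \<bullet> A y)"
proof -
  have "A (x + y) \<bullet> (x + y) = 0" using assms by (rule skewD)
  then show ?thesis
    using skewD[OF assms] by (simp add: linear_add inner_add_left inner_add_right inner_commute)
qed

text \<open>Turns a derivative in a variable direction into a sum of products with derivatives in
  fixed directions, to which the product rule applies.\<close>

lemma linear_coordinate_expansion: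
  fixes \<phi> :: "real^8 \<Rightarrow> real"
  assumes "linear \<phi>"
  shows "\<phi> v = (\<Sum>i\<in>UNIV. v $ i * \<phi> (axis i 1))"
proof -
  have "\<phi> v = \<phi> (\<Sum>i\<in>UNIV. v $ i *\<^sub>R axis i 1)"
    using basis_expansion[of v] by (simp add: scalar_mult_eq_scaleR)
  then show ?thesis by (simp add: linear_sum[OF assms] linear_scale[OF assms])
qed

text \<open>The explicit extension, on the same open set, is what allows a second field to be
  applied and the result computed.\<close>

lemma local_extension_skew:
  assumes UF: "local_extension f p U F" and A: "skew A"
  shows "local_extension (vf_apply A f) p U (\<lambda>x. frechet_derivative F (at x) (A x))"
proof -
  have U: "open U" "p \<in> U" and F: "\<And>k. Ck_on k U F"
    using UF by (auto simp: local_extension_def smooth_on_def)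
  have xe: "local_extension f x U F" if "x \<in> U" for x
    using UF that by (auto simp: local_extension_def)
  have D: "Ck_on k U (\<lambda>x. frechet_derivative F (at x) v)" for k v
    using F[of "Suc k"] by simp
  have lA: "linear (\<lambda>x. A x $ i)" for i
    by (rule linearI) (simp_all add: linear_add[OF skewD(1)[OF A]] linear_scale[OF skewD(1)[OF A]])
  have "Ck_on k U (\<lambda>x. \<Sum>i\<in>UNIV. A x $ i * frechet_derivative F (at x) (axis i 1))" for k
    by (intro Ck_on_sum Ck_on_mult U D Ck_on_linear lA) auto
  then have "Ck_on k U (\<lambda>x. frechet_derivative F (at x) (A x))" for k
    by (rule Ck_on_cong[OF U(1), rotated])
      (simp add: linear_coordinate_expansion[OF linear_frechet_derivative[OF
          local_extension_differentiable[OF xe]], symmetric])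
  moreover have "frechet_derivative F (at x) (A x) = vf_apply A f x" if "x \<in> U \<inter> S7" for x
    using tangent_deriv_eq[OF xe _ skewD(2)[OF A]] that by (simp add: vf_apply_def)
  ultimately show ?thesis
    using U by (simp add: local_extension_def smooth_on_def)
qed

lemma smooth_S7_skew: "f \<in> smooth_S7 \<Longrightarrow> skew A \<Longrightarrow> vf_apply A f \<in> smooth_S7"
  unfolding smooth_S7_def using local_extension_skew by blast

text \<open>Differentiating \<open>DF(x)(B x)\<close> along \<open>A p\<close> hits either
  \<open>DF\<close>, giving \<open>Q\<close>, or the linear field \<open>B\<close>, giving
  \<open>\<phi> (B (A p))\<close>. Since \<open>Q\<close> and \<open>\<phi>\<close> do not depend on
  \<open>A\<close> and \<open>B\<close>, commutators reduce to matrix algebra.\<close>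

lemma second_order_expansion:
  assumes f: "f \<in> smooth_S7" and p: "p \<in> S7"
  obtains Q \<phi> where "\<And>u. linear (Q u)" "\<And>v. linear (\<lambda>u. Q u v)" "\<And>u v. Q u v = Q v u"
    and "linear \<phi>" "\<And>v. v \<bullet> p = 0 \<Longrightarrow> tangent_deriv f p v = \<phi> v"
    and "\<And>A B. skew A \<Longrightarrow> skew B \<Longrightarrow> vf_apply A (vf_apply B f) p = Q (A p) (B p) + \<phi> (B (A p))"
proof -
  obtain U F where ext: "local_extension f p U F" using f p by (rule smooth_S7E)
  then have U: "open U" "p \<in> U" and F: "\<And>k. Ck_on k U F"
    by (auto simp: local_extension_def smooth_on_def)
  let ?D = "\<lambda>v x. frechet_derivative F (at x) v"
  define Q where "Q u v = frechet_derivative (?D u) (at p) v" for u v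
  have F1: "F differentiable (at x)" if "x \<in> U" for x
    using F[of "Suc 0"] that by simp
  have F2: "?D w differentiable (at x)" if "x \<in> U" for x w
    using F[of "Suc (Suc 0)"] that by simp
  have F3: "continuous_on U (\<lambda>x. frechet_derivative (?D w) (at x) z)" for w z
    using F[of "Suc (Suc 0)"] by simp
  have Qsym: "Q u v = Q v u" for u v
    unfolding Q_def by (rule second_derivative_symmetric[OF U F1 F2 F3])
  have Ql: "linear (Q u)" for u
    unfolding Q_def using F2[OF U(2)] by (rule linear_frechet_derivative)
  have Ql': "linear (\<lambda>u. Q u v)" for v
    unfolding Qsym[of _ v] by (rule Ql)
  have lD: "linear (\<lambda>v. ?D v x)" if "x \<in> U" for x
    using F1[OF that] by (rule linear_frechet_derivative)
  have second: "vf_apply A (vf_apply B f) p = Q (A p) (B p) + ?D (B (A p)) p"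
    if A: "skew A" and B: "skew B" for A B
  proof -
    have d: "((\<lambda>x. \<Sum>i\<in>UNIV. B x $ i * ?D (axis i 1) x) has_derivative
        (\<lambda>v. \<Sum>i\<in>UNIV. B p $ i * Q (axis i 1) v + B v $ i * ?D (axis i 1) p)) (at p)"
    proof (intro has_derivative_sum has_derivative_mult)
      fix i
      have "linear (\<lambda>x. B x $ i)"
        by (rule linearI) (simp_all add: linear_add[OF skewD(1)[OF B]] linear_scale[OF skewD(1)[OF B]])
      then show "((\<lambda>x. B x $ i) has_derivative (\<lambda>x. B x $ i)) (at p)"
        by (rule linear_imp_has_derivative)
      show "(?D (axis i 1) has_derivative Q (axis i 1)) (at p)"
        unfolding Q_def using F2[OF U(2)] by (simp add: frechet_derivative_works)
    qed
    have "((\<lambda>x. ?D (B x) x) has_derivative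
        (\<lambda>v. \<Sum>i\<in>UNIV. B p $ i * Q (axis i 1) v + B v $ i * ?D (axis i 1) p)) (at p)"
      by (rule has_derivative_transform_within_open[OF d U])
        (rule linear_coordinate_expansion[OF lD, symmetric])
    then have "frechet_derivative (\<lambda>x. ?D (B x) x) (at p)
       = (\<lambda>v. \<Sum>i\<in>UNIV. B p $ i * Q (axis i 1) v + B v $ i * ?D (axis i 1) p)"
      by (rule frechet_derivative_at[symmetric])
    also have "\<dots> = (\<lambda>v. Q (B p) v + ?D (B v) p)"
      unfolding sum.distrib linear_coordinate_expansion[OF Ql', symmetric]
        linear_coordinate_expansion[OF lD[OF U(2)], symmetric] ..
    finally show ?thesis
      using tangent_deriv_eq[OF local_extension_skew[OF ext B] p skewD(2)[OF A]]
      by (simp add: vf_apply_def[of A] Qsym)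
  qed
  show ?thesis
    using Ql Ql' Qsym lD[OF U(2)] tangent_deriv_eq[OF ext p] second by (rule that)
qed

section \<open>Algebra of the frame\<close>

lemma vec8_eq_iff:
  "(x :: real^8) = y \<longleftrightarrow> x$0 = y$0 \<and> x$1 = y$1 \<and> x$2 = y$2 \<and> x$3 = y$3
     \<and> x$4 = y$4 \<and> x$5 = y$5 \<and> x$6 = y$6 \<and> x$7 = y$7"
proof -
  have "(\<forall>i. P i) \<longleftrightarrow> (\<forall>i\<in>{0, 1, 2, 3, 4, 5, 6, 7}. P i)" for P :: "8 \<Rightarrow> bool"
    unfolding UNIV_8[symmetric] by simp
  then show ?thesis unfolding vec_eq_iff by simp
qed

lemma atLeastAtMost_2_7: "{2..7::nat} = {2, 3, 4, 5, 6, 7}"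
  by auto

lemma skew_X: "a \<in> {1..7} \<Longrightarrow> skew (X a)"
  by (simp add: skew_def linear_X X_tangent)

lemma X_X:
  assumes "a \<in> {1..7}"
  shows "X a (X a x) = - x"
  using assms unfolding atLeastAtMost_1_7
  by (elim insertE emptyE) (simp_all add: X_simps vec8_eq_iff)

lemma X_anticommute:
  assumes "a \<in> {2..7}"
  shows "X a (X 1 x) = - X 1 (X a x)"
  using assms unfolding atLeastAtMost_2_7
  by (elim insertE emptyE) (simp_all add: X_simps vec8_eq_iff)

text \<open>A product of two antisymmetric matrices that anticommute is again antisymmetric. Hence
  the commutator field is itself skew and may be inserted into
  \<open>second_order_expansion\<close>.\<close>

lemma skew_X1_X:
  assumes a: "a \<in> {2..7}"
  shows "skew (\<lambda>x. X 1 (X a x))"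
  unfolding skew_def
proof (intro conjI allI)
  show "linear (\<lambda>x. X 1 (X a x))"
    using linear_compose[OF linear_X linear_X] by (simp add: o_def)
  show "X 1 (X a x) \<bullet> x = 0" for x
    using a unfolding atLeastAtMost_2_7
    by (elim insertE emptyE) (simp_all add: X_simps inner_8)
qed

text \<open>On the sphere the frame together with the radial vector \<open>x\<close> is an
  orthonormal basis of the ambient space.\<close>

lemma X_complete:
  assumes "x \<in> S7"
  shows "(\<Sum>a=1..7. (X a x \<bullet> w) *\<^sub>R X a x) + (x \<bullet> w) *\<^sub>R x = w"
proof -
  have "x \<bullet> x = 1" using assms by (simp add: dot_square_norm)
  then have 1: "x$0 * x$0 + x$1 * x$1 + x$2 * x$2 + x$3 * x$3
     + x$4 * x$4 + x$5 * x$5 + x$6 * x$6 + x$7 * x$7 = 1" (is "?s = 1")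
    by (simp only: inner_8)
  \<comment> \<open>A polynomial identity for all \<open>x\<close>; the sphere enters only through
    \<open>?s = 1\<close>.\<close>
  have "(\<Sum>a=1..7. (X a x \<bullet> w) *\<^sub>R X a x) + (x \<bullet> w) *\<^sub>R x = ?s *\<^sub>R w"
    unfolding atLeastAtMost_1_7 by (simp add: X_simps vec8_eq_iff inner_8 algebra_simps)
  then show ?thesis by (simp add: 1)
qed

lemma X_parseval:
  assumes "x \<in> S7"
  shows "(\<Sum>a=1..7. (X a x \<bullet> w)\<^sup>2) + (x \<bullet> w)\<^sup>2 = w \<bullet> w"
proof -
  have "w \<bullet> w = ((\<Sum>a=1..7. (X a x \<bullet> w) *\<^sub>R X a x) + (x \<bullet> w) *\<^sub>R x) \<bullet> w"
    by (simp only: X_complete[OF assms])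
  then show ?thesis
    by (simp add: inner_add_left inner_sum_left power2_eq_square)
qed

text \<open>Conceptually, the sum of the projections onto the \<open>X a x\<close> is
  \<open>(x \<bullet> x) I\<close> minus those onto \<open>x\<close> and \<open>X 1 x\<close>.
  Multiplied by the matrix of \<open>X 1\<close> it becomes \<open>(x \<bullet> x) X 1\<close> minus
  \<open>(X 1 x)\<close> times \<open>x\<close> transposed plus \<open>x\<close> times
  \<open>(X 1 x)\<close> transposed, which is antisymmetric. The proof checks the 64 entries
  directly.\<close>

lemma X_trace_antisymmetric:
  "(\<Sum>a=2..7. X 1 (X a x) $ i * X a x $ j) = - (\<Sum>a=2..7. X 1 (X a x) $ j * X a x $ i)"
proof -
  have "\<forall>i\<in>{0, 1, 2, 3, 4, 5, 6, 7}. \<forall>j\<in>{0, 1, 2, 3, 4, 5, 6, 7}.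
    (\<Sum>a=2..7. X 1 (X a x) $ i * X a x $ j) = - (\<Sum>a=2..7. X 1 (X a x) $ j * X a x $ i)"
    unfolding atLeastAtMost_2_7 by (simp add: X_simps)
  then show ?thesis unfolding UNIV_8[symmetric] by blast
qed

lemma X_trace_zero:
  assumes l: "\<And>u. linear (Q u)" "\<And>v. linear (\<lambda>u. Q u v)" and s: "\<And>u v. Q u v = Q v u"
  shows "(\<Sum>a=2..7. Q (X 1 (X a x)) (X a x)) = (0 :: real)"
proof -
  define T where "T i j = (\<Sum>a=2..7. X 1 (X a x) $ i * X a x $ j)" for i j
  define q where "q i j = Q (axis i 1) (axis j 1)" for i j
  have T: "T i j = - T j i" for i j
    unfolding T_def by (rule X_trace_antisymmetric)
  have q: "q i j = q j i" for i j
    unfolding q_def by (rule s)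
  have "Q u v = (\<Sum>i\<in>UNIV. \<Sum>j\<in>UNIV. u $ i * v $ j * q i j)" for u v
    unfolding linear_coordinate_expansion[OF l(2), of u v] q_def
    by (subst linear_coordinate_expansion[OF l(1)]) (simp add: sum_distrib_left mult.assoc)
  then have "(\<Sum>a=2..7. Q (X 1 (X a x)) (X a x))
      = (\<Sum>a=2..7. \<Sum>i\<in>UNIV. \<Sum>j\<in>UNIV. X 1 (X a x) $ i * X a x $ j * q i j)"
    by simp
  also have "\<dots> = (\<Sum>i\<in>UNIV. \<Sum>a=2..7. \<Sum>j\<in>UNIV. X 1 (X a x) $ i * X a x $ j * q i j)"
    by (rule sum.swap)
  also have "\<dots> = (\<Sum>i\<in>UNIV. \<Sum>j\<in>UNIV. T i j * q i j)"
    unfolding T_def sum_distrib_right by (intro sum.cong refl sum.swap)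
  finally have 1: "(\<Sum>a=2..7. Q (X 1 (X a x)) (X a x)) = (\<Sum>i\<in>UNIV. \<Sum>j\<in>UNIV. T i j * q i j)" .
  \<comment> \<open>Exchanging the indices shows that the sum equals its own negative.\<close>
  have "(\<Sum>i\<in>UNIV. \<Sum>j\<in>UNIV. T i j * q i j) = (\<Sum>j\<in>UNIV. \<Sum>i\<in>UNIV. T i j * q i j)"
    by (rule sum.swap)
  also have "\<dots> = (\<Sum>j\<in>UNIV. \<Sum>i\<in>UNIV. - (T j i * q j i))"
    by (intro sum.cong refl) (metis T q mult_minus_left)
  also have "\<dots> = - (\<Sum>i\<in>UNIV. \<Sum>j\<in>UNIV. T i j * q i j)"
    by (simp add: sum_negf)
  finally show ?thesis unfolding 1 by simp
qed

section \<open>Commutation with the sum of squares\<close>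

text \<open>The \<open>Q\<close> terms cancel by symmetry. Composing derivations reverses the matrix
  product, so what remains is \<open>\<phi>\<close> of \<open>X a (X 1 x) - X 1 (X a x)\<close>,
  which anticommutation turns into the factor -2.\<close>

lemma X1_X_commutator:
  assumes h: "h \<in> smooth_S7" and x: "x \<in> S7" and a: "a \<in> {2..7}"
  shows "vf_apply (X 1) (vf_apply (X a) h) x
    = vf_apply (X a) (vf_apply (X 1) h) x + (- 2) * vf_apply (\<lambda>x. X 1 (X a x)) h x"
proof -
  have sk: "skew (X 1)" "skew (X a)" using a by (auto intro: skew_X)
  obtain Q \<phi> where Q: "\<And>u. linear (Q u)" "\<And>v. linear (\<lambda>u. Q u v)" "\<And>u v. Q u v = Q v u"
    and \<phi>: "linear \<phi>" "\<And>v. v \<bullet> x = 0 \<Longrightarrow> tangent_deriv h x v = \<phi> v"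
    and XX: "\<And>A B. skew A \<Longrightarrow> skew B \<Longrightarrow> vf_apply A (vf_apply B h) x = Q (A x) (B x) + \<phi> (B (A x))"
    using h x that by (rule second_order_expansion)
  have "vf_apply (\<lambda>x. X 1 (X a x)) h x = \<phi> (X 1 (X a x))"
    unfolding vf_apply_def by (rule \<phi>(2)[OF skewD(2)[OF skew_X1_X[OF a]]])
  then show ?thesis
    using Q(3)[of "X a x" "X 1 x"]
    by (simp only: XX[OF sk] XX[OF sk(2,1)] X_anticommute[OF a])
      (simp add: linear_neg[OF \<phi>(1)])
qed

lemma X1_commutes_sum_squares:
  assumes f: "f \<in> smooth_S7" and p: "p \<in> S7"
  shows "vf_apply (X 1) (\<lambda>x. \<Sum>a=2..7. X_squared a f x) p = (\<Sum>a=2..7. X_squared a (vf_apply (X 1) f) p)"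
proof -
  have sk1: "skew (X 1)" by (simp add: skew_X)
  obtain Q \<phi> where Q: "\<And>u. linear (Q u)" "\<And>v. linear (\<lambda>u. Q u v)" "\<And>u v. Q u v = Q v u"
    and \<phi>: "linear \<phi>" "\<And>v. v \<bullet> p = 0 \<Longrightarrow> tangent_deriv f p v = \<phi> v"
    and XX: "\<And>A B. skew A \<Longrightarrow> skew B \<Longrightarrow> vf_apply A (vf_apply B f) p = Q (A p) (B p) + \<phi> (B (A p))"
    using f p that by (rule second_order_expansion)
  \<comment> \<open>Moving \<open>X 1\<close> past the two factors \<open>X a\<close> one at a time
    yields one commutator term on each side of the remaining \<open>X a\<close>.\<close>
  have comm: "vf_apply (X 1) (X_squared a f) p
      = X_squared a (vf_apply (X 1) f) p - 4 * Q (X 1 (X a p)) (X a p)"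
    if a: "a \<in> {2..7}" for a
  proof -
    let ?C = "\<lambda>x. X 1 (X a x)"
    have sk: "skew (X a)" "skew ?C" using a skew_X1_X by (auto intro: skew_X)
    note sm = smooth_S7_skew[OF f sk(1)] smooth_S7_skew[OF f sk(2)]
      smooth_S7_skew[OF smooth_S7_skew[OF f sk1] sk(1)]
    note t = skewD(2)[OF sk(1)]
    have "vf_apply (X 1) (X_squared a f) p
        = vf_apply (X a) (vf_apply (X 1) (vf_apply (X a) f)) p + (- 2) * vf_apply ?C (vf_apply (X a) f) p"
      unfolding X_squared_def by (rule X1_X_commutator[OF sm(1) p a])
    \<comment> \<open>The commutator identity holds on the entire sphere, so it may be
      differentiated along \<open>X a\<close>.\<close>
    also have "vf_apply (X a) (vf_apply (X 1) (vf_apply (X a) f))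
        = vf_apply (X a) (\<lambda>x. vf_apply (X a) (vf_apply (X 1) f) x + (- 2) * vf_apply ?C f x)"
      by (rule vf_apply_cong) (rule X1_X_commutator[OF f _ a])
    also have "\<dots> p = X_squared a (vf_apply (X 1) f) p + (- 2) * vf_apply (X a) (vf_apply ?C f) p"
      unfolding X_squared_def vf_apply_def
      by (rule tangent_deriv_add_scaled[OF sm(3,2)[unfolded vf_apply_def] p t])
    \<comment> \<open>Here \<open>?C (X a p) = - X 1 p\<close>, while
      \<open>X a (?C p) = X 1 p\<close> in the other order; so the first-order terms cancel.\<close>
    also have "vf_apply (X a) (vf_apply ?C f) p = Q (?C p) (X a p) - \<phi> (X 1 p)"
      using a by (simp only: XX[OF sk] Q(3)[of "X a p"] X_X[of a] linear_neg[OF linear_X])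
        (simp add: linear_neg[OF \<phi>(1)] X_X linear_neg[OF linear_X])
    also have "vf_apply ?C (vf_apply (X a) f) p = Q (?C p) (X a p) + \<phi> (X 1 p)"
      using a by (simp only: XX[OF sk(2,1)] X_anticommute[OF a])
        (simp add: X_X linear_neg[OF linear_X])
    finally show ?thesis by simp
  qed
  have sm: "X_squared a f \<in> smooth_S7" if "a \<in> {2..7}" for a
    using that unfolding X_squared_def by (intro smooth_S7_skew f skew_X) auto
  have "vf_apply (X 1) (\<lambda>x. \<Sum>a=2..7. X_squared a f x) p = (\<Sum>a=2..7. vf_apply (X 1) (X_squared a f) p)"
    unfolding vf_apply_def by (rule tangent_deriv_sum[OF _ sm p skewD(2)[OF sk1]]) auto
  also have "\<dots> = (\<Sum>a=2..7. X_squared a (vf_apply (X 1) f) p - 4 * Q (X 1 (X a p)) (X a p))"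
    by (intro sum.cong refl comm)
  also have "\<dots> = (\<Sum>a=2..7. X_squared a (vf_apply (X 1) f) p)"
    using X_trace_zero[of Q p, OF Q] by (simp add: sum_subtractf sum_distrib_left[symmetric])
  finally show ?thesis .
qed

section \<open>The sub-Laplacian as a sum of squares\<close>

lemma contact_distribution_tangent:
  assumes "w \<in> contact_distribution p"
  shows "w \<bullet> p = 0"
  using assms unfolding contact_distribution_def
proof (rule span_induct)
  show "subspace {w. w \<bullet> p = 0}"
    by (auto simp: subspace_def inner_add_left)
  show "w \<bullet> p = 0" if "w \<in> (\<lambda>a. X a p) ` {2..7}" for w
    using that X_tangent by auto
qed

text \<open>The vector on the right represents the derivative on each frame vector, hence on their
  span.\<close>

lemma horizontal_gradient_frame:
  assumes f: "f \<in> smooth_S7" and p: "p \<in> S7"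
  shows "horizontal_gradient f p = (\<Sum>b=2..7. vf_apply (X b) f p *\<^sub>R X b p)"
proof -
  define v where "v = (\<Sum>b=2..7. vf_apply (X b) f p *\<^sub>R X b p)"
  obtain \<phi> where \<phi>: "linear \<phi>" "\<And>v. v \<bullet> p = 0 \<Longrightarrow> tangent_deriv f p v = \<phi> v"
    using f p that by (rule tangent_deriv_as_linear)
  have vX: "v \<bullet> X a p = \<phi> (X a p)" if a: "a \<in> {2..7}" for a
  proof -
    have "v \<bullet> X a p = (\<Sum>b=2..7. if b = a then vf_apply (X b) f p else 0)"
      unfolding v_def inner_sum_left
      by (intro sum.cong refl) (use a X_orthonormal[OF p] in auto)
    also have "\<dots> = vf_apply (X a) f p" using a by simp
    also have "\<dots> = \<phi> (X a p)"
      unfolding vf_apply_def using a by (intro \<phi> X_tangent) auto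
    finally show ?thesis .
  qed
  have v1: "v \<in> contact_distribution p"
    unfolding v_def contact_distribution_def
    by (intro span_sum span_scale span_base) auto
  have "v \<bullet> w = \<phi> w" if "w \<in> contact_distribution p" for w
    using that unfolding contact_distribution_def
  proof (rule span_induct)
    show "subspace {w. v \<bullet> w = \<phi> w}"
      using \<phi>(1) by (auto simp: subspace_def inner_add_right linear_add linear_scale linear_0)
    show "v \<bullet> w = \<phi> w" if "w \<in> (\<lambda>a. X a p) ` {2..7}" for w
      using that vX by auto
  qed
  then have v2: "\<forall>w\<in>contact_distribution p. v \<bullet> w = tangent_deriv f p w"
    using \<phi>(2) contact_distribution_tangent by simp
  show ?thesis
    unfolding horizontal_gradient_def v_def[symmetric]
  proof (rule the_equality)
    show "v \<in> contact_distribution p \<and> (\<forall>w\<in>contact_distribution p. v \<bullet> w = tangent_deriv f p w)"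
      using v1 v2 by simp
  next
    fix u
    assume u: "u \<in> contact_distribution p \<and> (\<forall>w\<in>contact_distribution p. u \<bullet> w = tangent_deriv f p w)"
    have "u - v \<in> contact_distribution p"
      using u v1 unfolding contact_distribution_def by (blast intro: span_diff)
    \<comment> \<open>Two representing vectors are compared on their own difference, which is again
      horizontal.\<close>
    then have "u \<bullet> (u - v) = v \<bullet> (u - v)" using u v2 by simp
    then have "(u - v) \<bullet> (u - v) = 0" by (simp add: inner_diff_left)
    then show "u = v" by simp
  qed
qed

section \<open>Brackets of the frame and Popp's density\<close>

lemma linear_X_nth: "linear (\<lambda>x. X a x $ i)"
  by (rule linearI) (simp_all add: linear_add[OF linear_X] linear_scale[OF linear_X])

text \<open>For linear fields the bracket is the matrix commutator with reversed sign, because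
  \<open>X a\<close> acting on the coefficients of \<open>X b\<close> gives
  \<open>X b (X a p)\<close>.\<close>

lemma lie_bracket_X:
  assumes p: "p \<in> S7" and ab: "a \<in> {1..7}" "b \<in> {1..7}"
  shows "lie_bracket (X a) (X b) p = X b (X a p) - X a (X b p)"
  using tangent_deriv_linear[OF linear_X_nth p X_tangent[OF ab(1)], of b]
    tangent_deriv_linear[OF linear_X_nth p X_tangent[OF ab(2)], of a]
  by (simp add: lie_bracket_def vf_apply_def vec_eq_iff)

text \<open>For fixed \<open>j\<close> the structure coefficients are -2 times the frame
  coefficients of \<open>w = X j (X 1 p)\<close>. This is a unit vector orthogonal to
  \<open>p\<close> and \<open>X 1 p\<close>, so by Parseval their squares add up to 4; the six
  values of \<open>j\<close> give 24.\<close>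

lemma popp_density_constant:
  assumes p: "p \<in> S7"
  shows "popp_density p = 1 / sqrt 24"
proof -
  have "(\<Sum>i=2..7. (lie_bracket (X i) (X j) p \<bullet> X 1 p)\<^sup>2) = 4" if j: "j \<in> {2..7}" for j
  proof -
    define w where "w = X j (X 1 p)"
    have sj: "skew (X j)" and s1: "skew (X 1)" using j by (auto intro: skew_X)
    have "lie_bracket (X i) (X j) p \<bullet> X 1 p = - 2 * (X i p \<bullet> w)" if i: "i \<in> {2..7}" for i
    proof -
      have si: "skew (X i)" using i by (auto intro: skew_X)
      have "X j (X i p) \<bullet> X 1 p = - (X i p \<bullet> w)"
        unfolding w_def by (rule skew_inner[OF sj])
      moreover have "X i (X j p) \<bullet> X 1 p = - (X j p \<bullet> X i (X 1 p))"
        by (rule skew_inner[OF si])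
      moreover have "\<dots> = X j p \<bullet> X 1 (X i p)"
        unfolding X_anticommute[OF i] by simp
      moreover have "\<dots> = - (X 1 (X j p) \<bullet> X i p)"
        using skew_inner[OF s1, of "X j p" "X i p"] by simp
      moreover have "\<dots> = X i p \<bullet> w"
        unfolding w_def X_anticommute[OF j] by (simp add: inner_commute)
      ultimately show ?thesis
        using i j by (simp add: lie_bracket_X[OF p] inner_diff_left)
    qed
    then have "(\<Sum>i=2..7. (lie_bracket (X i) (X j) p \<bullet> X 1 p)\<^sup>2) = 4 * (\<Sum>i=2..7. (X i p \<bullet> w)\<^sup>2)"
      unfolding sum_distrib_left by (intro sum.cong refl) (simp add: power_mult_distrib)
    also have "(\<Sum>i=2..7. (X i p \<bullet> w)\<^sup>2) = w \<bullet> w - (p \<bullet> w)\<^sup>2 - (X 1 p \<bullet> w)\<^sup>2"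
      using X_parseval[OF p, of w] by (subst (asm) sum.atLeast_Suc_atMost) (simp_all add: numeral_2_eq_2)
    also have "p \<bullet> w = 0"
      using skew_inner[OF sj, of p "X 1 p"] X_orthonormal[OF p, of j 1] j unfolding w_def by simp
    also have "X 1 p \<bullet> w = 0"
      unfolding w_def using skewD(2)[OF sj] by (simp add: inner_commute)
    also have "w \<bullet> w = X 1 p \<bullet> X 1 p"
      using skew_inner[OF sj, of "X 1 p" w] j unfolding w_def by (simp add: X_X)
    also have "\<dots> = 1" using X_orthonormal[OF p, of 1 1] by simp
    finally show ?thesis by simp
  qed
  then have "(\<Sum>j=2..7. \<Sum>i=2..7. (lie_bracket (X i) (X j) p \<bullet> X 1 p)\<^sup>2) = 24"
    by simp
  then show ?thesis
    \<comment> \<open>The definition has \<open>j\<close> as the inner index, whereas the sum over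
      \<open>i\<close> was evaluated first.\<close>
    unfolding popp_density_def by (subst sum.swap) simp
qed

text \<open>With constant density only the bracket terms survive. For \<open>Y\<close> with frame
  coefficients \<open>g b\<close>, the \<open>X a\<close> component of \<open>[Y, X a]\<close> is
  minus the derivative of \<open>g a\<close> along \<open>X a\<close>: terms without a derivative of
  \<open>g\<close> drop out by skewness.\<close>

lemma sub_Laplacian_sum_squares:
  assumes f: "f \<in> smooth_S7" and p: "p \<in> S7"
  shows "sub_Laplacian f p = (\<Sum>a=2..7. X_squared a f p)"
proof -
  define g where "g b = vf_apply (X b) f" for b
  define Y where "Y = horizontal_gradient f"
  have Y: "Y x = (\<Sum>b=2..7. g b x *\<^sub>R X b x)" if "x \<in> S7" for x
    unfolding Y_def g_def using f that by (rule horizontal_gradient_frame)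
  have g: "g b \<in> smooth_S7" if "b \<in> {2..7}" for b
    unfolding g_def using that by (intro smooth_S7_skew f skew_X) auto
  have Yt: "Y p \<bullet> p = 0"
    unfolding Y[OF p] inner_sum_left by (rule sum.neutral) (simp add: X_tangent)
  have bracket: "lie_bracket Y (X a) p
      = X a (Y p) - (\<Sum>b=2..7. g b p *\<^sub>R X b (X a p) + vf_apply (X a) (g b) p *\<^sub>R X b p)"
    if a: "a \<in> {1..7}" for a
  proof -
    have "vf_apply (X a) (\<lambda>x. Y x $ i) p
        = (\<Sum>b=2..7. g b p * X b (X a p) $ i + vf_apply (X a) (g b) p * X b p $ i)" for i
    proof -
      \<comment> \<open>The frame formula for \<open>Y\<close> is available only on the sphere,
        which suffices for a tangential derivative.\<close>
      have "vf_apply (X a) (\<lambda>x. Y x $ i) = vf_apply (X a) (\<lambda>x. \<Sum>b=2..7. g b x * X b x $ i)"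
        by (rule vf_apply_cong) (simp add: Y)
      then have "vf_apply (X a) (\<lambda>x. Y x $ i) p = vf_apply (X a) (\<lambda>x. \<Sum>b=2..7. g b x * X b x $ i) p"
        by (rule fun_cong)
      also have "\<dots> = (\<Sum>b=2..7. vf_apply (X a) (\<lambda>x. g b x * X b x $ i) p)"
        unfolding vf_apply_def
        by (intro tangent_deriv_sum smooth_S7_mult g smooth_S7_linear linear_X_nth X_tangent a p) auto
      also have "\<dots> = (\<Sum>b=2..7. g b p * X b (X a p) $ i + vf_apply (X a) (g b) p * X b p $ i)"
        unfolding vf_apply_def
        by (intro sum.cong refl)
          (simp only: tangent_deriv_mult[OF g smooth_S7_linear[OF linear_X_nth] p X_tangent[OF a]]
            tangent_deriv_linear[OF linear_X_nth p X_tangent[OF a]])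
      finally show ?thesis .
    qed
    moreover have "vf_apply Y (\<lambda>x. X a x $ i) p = X a (Y p) $ i" for i
      unfolding vf_apply_def by (rule tangent_deriv_linear[OF linear_X_nth p Yt])
    ultimately show ?thesis by (simp add: lie_bracket_def vec_eq_iff)
  qed
  \<comment> \<open>The value is 0 for \<open>a = 1\<close> because \<open>Y\<close> has no
    component along \<open>X 1\<close>.\<close>
  have "lie_bracket Y (X a) p \<bullet> X a p = - (if a \<in> {2..7} then X_squared a f p else 0)"
    if a: "a \<in> {1..7}" for a
  proof -
    \<comment> \<open>Moving \<open>X a\<close> across and using that its square is -1 leaves
      \<open>Y p \<bullet> p\<close>, which vanishes by tangency.\<close>
    have "X a (Y p) \<bullet> X a p = 0"
      using skew_inner[OF skew_X[OF a], of "Y p" "X a p"] Yt by (simp add: X_X[OF a])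
    moreover have "X b (X a p) \<bullet> X a p = 0" if "b \<in> {2..7}" for b
      using that by (intro X_tangent) auto
    ultimately have "lie_bracket Y (X a) p \<bullet> X a p
        = - (\<Sum>b=2..7. vf_apply (X a) (g b) p * (X b p \<bullet> X a p))"
      by (simp add: bracket[OF a] inner_diff_left inner_sum_left inner_add_left)
    also have "(\<Sum>b=2..7. vf_apply (X a) (g b) p * (X b p \<bullet> X a p))
        = (\<Sum>b=2..7. if b = a then vf_apply (X a) (g b) p else 0)"
      by (intro sum.cong refl) (use a X_orthonormal[OF p] in auto)
    also have "\<dots> = (if a \<in> {2..7} then X_squared a f p else 0)"
      by (simp add: X_squared_def g_def)
    finally show ?thesis .
  qed
  then have "(\<Sum>a=1..7. lie_bracket Y (X a) p \<bullet> X a p)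
      = - (\<Sum>a=1..7. if a \<in> {2..7} then X_squared a f p else 0)"
    unfolding sum_negf[symmetric] by (intro sum.cong refl)
  also have "\<dots> = - (\<Sum>a=2..7. X_squared a f p)"
    by (subst sum.inter_restrict[symmetric]) (auto intro!: arg_cong2[where f=sum])
  finally have "(\<Sum>a=1..7. lie_bracket Y (X a) p \<bullet> X a p) = - (\<Sum>a=2..7. X_squared a f p)" .
  moreover have "vf_apply Y popp_density p = 0"
    using vf_apply_cong[of popp_density "\<lambda>x. 1 / sqrt 24" Y] popp_density_constant
      tangent_deriv_const[OF p Yt] by (simp add: vf_apply_def)
  ultimately show ?thesis
    by (simp add: sub_Laplacian_def popp_divergence_def Y_def)
qed

text \<open>The first conjunct identifies the intrinsic operator with the sum of squares. The second
  follows by moving \<open>X 1\<close> through that sum twice.\<close>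

theorem theorem5:
  shows "(\<forall>f\<in>smooth_S7. \<forall>p\<in>S7. sub_Laplacian f p = (\<Sum>a = 2..7. X_squared a f p)) \<and>
         commute_on_smooth_S7 sub_Laplacian (X_squared 1)"
proof (intro conjI ballI)
  fix f p
  assume "f \<in> smooth_S7" "p \<in> S7"
  then show "sub_Laplacian f p = (\<Sum>a = 2..7. X_squared a f p)"
    by (rule sub_Laplacian_sum_squares)
next
  have "sub_Laplacian (X_squared 1 f) p = X_squared 1 (sub_Laplacian f) p"
    if f: "f \<in> smooth_S7" and p: "p \<in> S7" for f p
  proof -
    let ?S = "\<lambda>f x. \<Sum>a=2..7. X_squared a f x"
    have sm: "vf_apply (X 1) f \<in> smooth_S7" using f by (simp add: smooth_S7_skew skew_X)
    then have sm2: "X_squared 1 f \<in> smooth_S7"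
      unfolding X_squared_def by (simp add: smooth_S7_skew skew_X)
    have "X_squared 1 (sub_Laplacian f) p = vf_apply (X 1) (vf_apply (X 1) (?S f)) p"
      using vf_apply_cong[OF sub_Laplacian_sum_squares[OF f]] by (simp add: X_squared_def)
    \<comment> \<open>The inner \<open>X 1\<close> is moved first, as an identity on the whole
      sphere; the outer one then meets the smooth function \<open>vf_apply (X 1) f\<close>.\<close>
    also have "\<dots> = vf_apply (X 1) (?S (vf_apply (X 1) f)) p"
      using vf_apply_cong[OF X1_commutes_sum_squares[OF f]] by (simp add: X_squared_def)
    also have "\<dots> = ?S (X_squared 1 f) p"
      using X1_commutes_sum_squares[OF sm p] by (simp add: X_squared_def)
    also have "\<dots> = sub_Laplacian (X_squared 1 f) p"
      using sub_Laplacian_sum_squares[OF sm2 p] by simp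
    finally show ?thesis by simp
  qed
  then show "commute_on_smooth_S7 sub_Laplacian (X_squared 1)"
    unfolding commute_on_smooth_S7_def by blast
qed

end
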